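(* No edge-based fixed-orientation algorithm guarantees any positive approximation for Pandora's Matching Problem: for every edge-based fixed-orientation algorithm $\textsc{Alg}$ and every $\alpha>0$ there exists an instance on which $\mathrm{Welfare}(\textsc{Alg})<\alpha\,\mathrm{Welfare}(\textsc{Opt})$.
   Context: Pandora's Matching Problem. An instance consists of a finite undirected graph $G=(V,E)$, not necessarily bipartite, and, for each edge $\{i,j\}\in E$, two Pandora boxes: box $(i,j)$ with a known distribution $D_{ij}$ over $\mathbb{R}$ (with finite mean) and a known cost $c_{ij}\ge 0$, and box $(j,i)$ with $D_{ji}$ and $c_{ji}\ge 0$. The values $v_{ij}\sim D_{ij}$ are drawn independently over all boxes. An algorithm repeatedly chooses an unopened box $(i,j)$, pays $c_{ij}$ and observes $v_{ij}$; its choices may depend on everything observed so far. Eventually it stops and outputs a matching of $G$ consisting only of edges both of whose boxes have been opened. Let $\mathbb{I}_{ij}$ indicate that box $(i,j)$ was opened and $\mathbb{A}_{ij}=\mathbb{A}_{ji}$ indicate that $\{i,j\}$ is in the output matching. The welfare of an algorithm is $\mathrm{Welfare}=\mathbb{E}\big[\sum_{(i,j)}(\mathbb{A}_{ij}v_{ij}-\mathbb{I}_{ij}c_{ij})\big]$, the sum over all boxes. $\textsc{Opt}$ denotes a welfare-maximizing algorithm. An algorithm guarantees approximation factor $\alpha$ if $\mathrm{Welfare}(\textsc{Alg})\ge\alpha\,\mathrm{Welfare}(\textsc{Opt})$ on every instance. An orientation $\mathcal{O}$ of $G$ is a set of ordered pairs containing, for each edge $\{i,j\}$, exactly one of $(i,j)$,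 $(j,i)$. An algorithm is $\mathcal{O}$-oriented if for every $(i,j)\in\mathcal{O}$, box $(j,i)$ is opened only if box $(i,j)$ was opened before it. An edge-based fixed-orientation algorithm is one that, given an instance, constructs an orientation $\mathcal{O}$ by applying a deterministic rule to each edge $\{i,j\}$ that depends only on that edge's parameters $D_{ij},c_{ij},D_{ji},c_{ji}$, and then runs some $\mathcal{O}$-oriented algorithm. *)

theory Defs
  imports "HOL-Probability.Probability"
begin

text \<open>
  Vertices are natural numbers; every finite graph has an isomorphic copy of this form.  The
  entries \<open>box_dist\<close> and \<open>box_cost\<close> only matter on the boxes, i.e. on the ordered pairs \<open>(i, j)\<close> with
  \<open>{i, j}\<close> an edge.
\<close>

record pandora =
  verts :: "nat set"
  edges :: "nat set set"
  box_dist :: "nat \<times> nat \<Rightarrow> real measure"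
  box_cost :: "nat \<times> nat \<Rightarrow> real"

definition boxes :: "pandora \<Rightarrow> (nat \<times> nat) set" where
  "boxes I = {(i, j). {i, j} \<in> edges I}"

definition pandora_instance :: "pandora \<Rightarrow> bool" where
  "pandora_instance I \<longleftrightarrow>
     finite (verts I) \<and>
     (\<forall>e\<in>edges I. e \<subseteq> verts I \<and> card e = 2) \<and>
     (\<forall>b\<in>boxes I. prob_space (box_dist I b) \<and> sets (box_dist I b) = sets borel \<and>
        integrable (box_dist I b) (\<lambda>x. x) \<and> 0 \<le> box_cost I b)"

definition value_space :: "pandora \<Rightarrow> (nat \<times> nat \<Rightarrow> real) measure" where
  "value_space I = PiM (boxes I) (box_dist I)"

definition matching :: "pandora \<Rightarrow> nat set set \<Rightarrow> bool" where
  "matching I M \<longleftrightarrow> M \<subseteq> edges I \<and> pairwise disjnt M"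

text \<open>
  An adaptive algorithm on a fixed instance is a decision tree: either stop and output a set of
  edges, or open a box and continue with a tree depending on the observed value.  A node of the
  tree thus knows all boxes opened on the way to it and all values found there.
\<close>

datatype policy = Stop "nat set set" | Open "nat \<times> nat" "real \<Rightarrow> policy"

primrec opened :: "policy \<Rightarrow> (nat \<times> nat \<Rightarrow> real) \<Rightarrow> (nat \<times> nat) set" where
  "opened (Stop M) v = {}"
| "opened (Open b k) v = insert b (opened (k (v b)) v)"

primrec outcome :: "policy \<Rightarrow> (nat \<times> nat \<Rightarrow> real) \<Rightarrow> nat set set" where
  "outcome (Stop M) v = M"
| "outcome (Open b k) v = outcome (k (v b)) v"

text \<open>In the next two functions, \<open>S\<close> is the set of boxes that have already been opened.\<close>

primrec feasible :: "pandora \<Rightarrow> (nat \<times> nat) set \<Rightarrow> policy \<Rightarrow> bool" where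
  "feasible I S (Stop M) \<longleftrightarrow> matching I M \<and> (\<forall>i j. {i, j} \<in> M \<longrightarrow> (i, j) \<in> S \<and> (j, i) \<in> S)"
| "feasible I S (Open b k) \<longleftrightarrow> b \<in> boxes I \<and> b \<notin> S \<and> (\<forall>x. feasible I (insert b S) (k x))"

primrec oriented :: "(nat \<times> nat) set \<Rightarrow> (nat \<times> nat) set \<Rightarrow> policy \<Rightarrow> bool" where
  "oriented R S (Stop M) \<longleftrightarrow> True"
| "oriented R S (Open b k) \<longleftrightarrow>
     ((snd b, fst b) \<in> R \<longrightarrow> (snd b, fst b) \<in> S) \<and> (\<forall>x. oriented R (insert b S) (k x))"

text \<open>
  The indicators of ``box \<open>b\<close> is opened'' and ``edge \<open>e\<close> is matched'' have to be random
  variables, as otherwise the welfare of the algorithm is not defined.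
\<close>

definition algorithm :: "pandora \<Rightarrow> policy \<Rightarrow> bool" where
  "algorithm I p \<longleftrightarrow>
     feasible I {} p \<and>
     (\<forall>b\<in>boxes I. Measurable.pred (value_space I) (\<lambda>v. b \<in> opened p v)) \<and>
     (\<forall>e\<in>edges I. Measurable.pred (value_space I) (\<lambda>v. e \<in> outcome p v))"

definition welfare :: "pandora \<Rightarrow> policy \<Rightarrow> real" where
  "welfare I p = (\<integral>v. (\<Sum>(i, j)\<in>boxes I.
       of_bool ({i, j} \<in> outcome p v) * v (i, j)
       - of_bool ((i, j) \<in> opened p v) * box_cost I (i, j)) \<partial>value_space I)"

definition optimal :: "pandora \<Rightarrow> policy \<Rightarrow> bool" where
  "optimal I p \<longleftrightarrow> algorithm I p \<and> (\<forall>q. algorithm I q \<longrightarrow> welfare I q \<le> welfare I p)"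

definition orientation :: "pandora \<Rightarrow> (nat \<times> nat) set \<Rightarrow> bool" where
  "orientation I R \<longleftrightarrow> R \<subseteq> boxes I \<and> (\<forall>(i, j)\<in>boxes I. (i, j) \<in> R \<longleftrightarrow> (j, i) \<notin> R)"

text \<open>
  An edge rule takes the parameters \<open>D\<^sub>i\<^sub>j, c\<^sub>i\<^sub>j, D\<^sub>j\<^sub>i, c\<^sub>j\<^sub>i\<close> and says whether \<open>(i, j)\<close> (rather than
  \<open>(j, i)\<close>) belongs to the orientation.  If the two boxes of an edge have the same parameters, no
  such rule can tell them apart, and either direction of this edge is accepted.
\<close>

type_synonym edge_rule = "real measure \<Rightarrow> real \<Rightarrow> real measure \<Rightarrow> real \<Rightarrow> bool"

definition obeys_rule :: "edge_rule \<Rightarrow> pandora \<Rightarrow> (nat \<times> nat) set \<Rightarrow> bool" where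
  "obeys_rule rule I R \<longleftrightarrow>
     (\<forall>(i, j)\<in>boxes I. (box_dist I (i, j), box_cost I (i, j)) \<noteq> (box_dist I (j, i), box_cost I (j, i)) \<longrightarrow>
        ((i, j) \<in> R \<longleftrightarrow> rule (box_dist I (i, j)) (box_cost I (i, j)) (box_dist I (j, i)) (box_cost I (j, i))))"

definition edge_based_fixed_orientation :: "(pandora \<Rightarrow> policy) \<Rightarrow> bool" where
  "edge_based_fixed_orientation alg \<longleftrightarrow>
     (\<exists>rule. \<forall>I. pandora_instance I \<longrightarrow>
        algorithm I (alg I) \<and>
        (\<exists>R. orientation I R \<and> obeys_rule rule I R \<and> oriented R {} (alg I)))"

end

theory Submission imports Defs begin

text \<open>
  Consider a star with \<open>n\<close> leaves.  At every edge, the \<^emph>\<open>prize\<close> box \<open>(0, i)\<close> holds \<open>1 / p\<close> with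
  probability \<open>p\<close> and \<open>0\<close> otherwise, and costs \<open>(1 - \<delta>) / 2\<close>; the \<^emph>\<open>veto\<close> box \<open>(i, 0)\<close> holds \<open>1\<close> or the
  prohibitive value \<open>- 1 / p\<close> with equal probability, and costs \<open>1 / 2\<close>.  An edge rule must direct all
  edges of all these stars alike.

  \<^item> Prize first: since half of the prizes are vetoed, each prize box yields only \<open>\<delta> / 2\<close> net of
    costs.  On a single edge this loses against opening the veto box first, which saves the cost
    of the prize box in half of the cases and earns \<open>(1 + \<delta>) / 4\<close>.
  \<^item> Veto first: finding a prize takes about \<open>1 / p\<close> trials, each of which now costs an additional
    \<open>1 / 2\<close>, so that the welfare is at most \<open>1\<close> for every \<open>n\<close>.  Opening prize boxes until a prize is
    found, and only then its veto box, earns \<open>\<delta> / (2 p)\<close> in the limit of large \<open>n\<close>.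

  Both ratios are arbitrarily small for \<open>p = \<delta>\<^sup>2\<close> and \<open>\<delta> \<rightarrow> 0\<close>.
\<close>

section \<open>Probability mass functions\<close>

definition borel_pmf :: "'a::topological_space pmf \<Rightarrow> 'a measure" where
  "borel_pmf X = distr (measure_pmf X) borel (\<lambda>x. x)"

lemma sets_borel_pmf [simp]: "sets (borel_pmf X) = sets borel"
  by (simp add: borel_pmf_def)

lemma prob_space_borel_pmf: "prob_space (borel_pmf X)"
  unfolding borel_pmf_def by (rule measure_pmf.prob_space_distr) simp

lemma integrable_borel_pmf:
  fixes f :: "'a::topological_space \<Rightarrow> 'b::{banach, second_countable_topology}"
  assumes "finite (set_pmf X)" "f \<in> borel_measurable borel"
  shows "integrable (borel_pmf X) f"
  using assms by (simp add: borel_pmf_def integrable_distr_eq integrable_measure_pmf_finite)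

lemma PiM_distr_pmf:
  assumes "finite B" and space_N: "\<And>b. space (N b) = UNIV"
  shows "PiM B (\<lambda>b. distr (measure_pmf (P b)) (N b) (\<lambda>x. x)) =
    distr (Pi_pmf B d P) (PiM B N) (\<lambda>v. restrict v B)"
proof -
  let ?M = "\<lambda>b. distr (measure_pmf (P b)) (N b) (\<lambda>x. x)"
  let ?Q = "measure_pmf (Pi_pmf B d P)"
  interpret product_prob_space ?M B
    by (intro product_prob_spaceI measure_pmf.prob_space_distr) (simp add: space_N)
  have "distr ?Q (PiM B N) (\<lambda>v. restrict v B) = PiM B ?M"
  proof (rule PiM_eqI[OF \<open>finite B\<close>])
    show "sets (distr ?Q (PiM B N) (\<lambda>v. restrict v B)) = sets (PiM B ?M)"
      by (simp cong: sets_PiM_cong)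
  next
    fix A assume A: "\<And>b. b \<in> B \<Longrightarrow> A b \<in> sets (?M b)"
    have "emeasure (distr ?Q (PiM B N) (\<lambda>v. restrict v B)) (Pi\<^sub>E B A) =
        emeasure ?Q ((\<lambda>v. restrict v B) -` Pi\<^sub>E B A)"
      using A \<open>finite B\<close>
      by (subst emeasure_distr) (auto simp: space_PiM space_N intro!: sets_PiM_I_finite)
    also have "(\<lambda>v. restrict v B) -` Pi\<^sub>E B A = Pi B A"
      by auto
    also have "emeasure ?Q (Pi B A) = (\<Prod>b\<in>B. emeasure (P b) (A b))"
      by (simp add: measure_pmf.emeasure_eq_measure measure_Pi_pmf_Pi \<open>finite B\<close> prod_ennreal)
    also have "\<dots> = (\<Prod>b\<in>B. emeasure (?M b) (A b))"
      using A by (intro prod.cong refl) (simp add: emeasure_distr space_N)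
    finally show "emeasure (distr ?Q (PiM B N) (\<lambda>v. restrict v B)) (Pi\<^sub>E B A) =
        (\<Prod>b\<in>B. emeasure (?M b) (A b))" .
  qed
  then show ?thesis
    by simp
qed

lemma Pi_pmf_resample:
  assumes "finite B" "b \<in> B"
  shows "Pi_pmf B d P = bind_pmf (P b) (\<lambda>x. map_pmf (\<lambda>v. v(b := x)) (Pi_pmf B d P))"
proof -
  have "Pi_pmf B d P = bind_pmf (P b) (\<lambda>x. map_pmf (\<lambda>v. v(b := x)) (Pi_pmf (B - {b}) d P))"
    using Pi_pmf_insert'[of "B - {b}" b d P] assms by (simp add: insert_absorb map_pmf_def)
  then show ?thesis
    using \<open>finite B\<close> by (simp add: Pi_pmf_remove pmf.map_comp o_def)
qed

lemma expectation_bind_pmf_finite: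
  fixes h :: "'b \<Rightarrow> 'c::{banach, second_countable_topology}"
  assumes "finite (set_pmf X)" "\<And>x. x \<in> set_pmf X \<Longrightarrow> finite (set_pmf (F x))"
  shows "measure_pmf.expectation (bind_pmf X F) h =
    measure_pmf.expectation X (\<lambda>x. measure_pmf.expectation (F x) h)"
  using assms
  by (simp add: pmf_expectation_bind[of "set_pmf X"] integral_measure_pmf[of "set_pmf X"])

lemma expectation_pmf_if_eq:
  fixes a b :: real
  shows "measure_pmf.expectation X (\<lambda>x. if x = t then a else b) =
    pmf X t * a + (1 - pmf X t) * b"
proof -
  have "(\<lambda>x. if x = t then a else b) = (\<lambda>x. b + (a - b) * indicator {t} x)"
    by (auto simp: indicator_def)
  then show ?thesis
    by (simp add: measure_pmf_single measure_pmf.emeasure_eq_measure algebra_simps)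
qed

definition two_point_pmf :: "real \<Rightarrow> 'a \<Rightarrow> 'a \<Rightarrow> 'a pmf" where
  "two_point_pmf p a b = map_pmf (\<lambda>s. if s then a else b) (bernoulli_pmf p)"

lemma set_two_point_pmf_subset: "set_pmf (two_point_pmf p a b) \<subseteq> {a, b}"
  by (auto simp: two_point_pmf_def)

lemma expectation_two_point_pmf:
  fixes f :: "'a \<Rightarrow> real"
  assumes "0 \<le> p" "p \<le> 1"
  shows "measure_pmf.expectation (two_point_pmf p a b) f = p * f a + (1 - p) * f b"
  using assms by (simp add: two_point_pmf_def mult.commute)

lemma pmf_two_point_pmf_left:
  assumes "0 \<le> p" "p \<le> 1" "a \<noteq> b"
  shows "pmf (two_point_pmf p a b) a = p"
proof -
  have "(\<lambda>s. if s then a else b) -` {a} = {True}"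
    using assms by (auto split: if_splits)
  then show ?thesis
    using assms by (simp add: two_point_pmf_def pmf_map measure_pmf_single)
qed

section \<open>Policies and their welfare\<close>

definition matched_value :: "pandora \<Rightarrow> nat set set \<Rightarrow> (nat \<times> nat \<Rightarrow> real) \<Rightarrow> real" where
  "matched_value I M v = (\<Sum>(i, j)\<in>boxes I. of_bool ({i, j} \<in> M) * v (i, j))"

definition payoff :: "pandora \<Rightarrow> policy \<Rightarrow> (nat \<times> nat \<Rightarrow> real) \<Rightarrow> real" where
  "payoff I p v = matched_value I (outcome p v) v - sum (box_cost I) (boxes I \<inter> opened p v)"

definition measurable_policy :: "pandora \<Rightarrow> policy \<Rightarrow> bool" where
  "measurable_policy I p \<longleftrightarrow>
     (\<forall>b\<in>boxes I. Measurable.pred (value_space I) (\<lambda>v. b \<in> opened p v)) \<and>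
     (\<forall>e\<in>edges I. Measurable.pred (value_space I) (\<lambda>v. e \<in> outcome p v))"

definition branch :: "nat \<times> nat \<Rightarrow> real set \<Rightarrow> policy \<Rightarrow> policy \<Rightarrow> policy" where
  "branch b A p q = Open b (\<lambda>x. if x \<in> A then p else q)"

lemma algorithm_iff: "algorithm I p \<longleftrightarrow> feasible I {} p \<and> measurable_policy I p"
  by (simp add: algorithm_def measurable_policy_def)

lemma matched_value_empty [simp]: "matched_value I {} v = 0"
  by (simp add: matched_value_def case_prod_beta)

lemma opened_subset: "feasible I S p \<Longrightarrow> opened p v \<subseteq> boxes I - S"
proof (induction p arbitrary: S)
  case (Open b k)
  then have "opened (k (v b)) v \<subseteq> boxes I - insert b S"
    by simp
  then show ?case
    using Open.prems by auto
qed simp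

lemma outcome_subset_edges: "feasible I S p \<Longrightarrow> outcome p v \<subseteq> edges I"
  by (induction p arbitrary: S) (auto simp: matching_def)

lemma feasible_Stop_empty [simp]: "feasible I S (Stop {})"
  by (simp add: matching_def)

lemma feasible_branch:
  assumes "b \<in> boxes I" "b \<notin> S" "feasible I (insert b S) p" "feasible I (insert b S) q"
  shows "feasible I S (branch b A p q)"
  using assms by (simp add: branch_def)

locale valid_instance =
  fixes I :: pandora
  assumes pandora_instance: "pandora_instance I"
begin

lemma finite_boxes: "finite (boxes I)"
proof (rule finite_subset)
  show "boxes I \<subseteq> verts I \<times> verts I"
    using pandora_instance by (auto simp: boxes_def pandora_instance_def)
  show "finite (verts I \<times> verts I)"
    using pandora_instance by (simp add: pandora_instance_def)
qed

lemma finite_edges: "finite (edges I)"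
  by (rule finite_subset[of _ "Pow (verts I)"])
     (use pandora_instance in \<open>auto simp: pandora_instance_def\<close>)

lemma sets_value_space: "sets (value_space I) = sets (PiM (boxes I) (\<lambda>_. borel))"
  unfolding value_space_def
  using pandora_instance by (intro sets_PiM_cong) (auto simp: pandora_instance_def)

lemma measurable_component_value_space:
  "b \<in> boxes I \<Longrightarrow> (\<lambda>v. v b) \<in> borel_measurable (value_space I)"
  by (subst measurable_cong_sets[OF sets_value_space refl]) simp

lemma payoff_eq_sum:
  "payoff I p v = (\<Sum>(i, j)\<in>boxes I.
     of_bool ({i, j} \<in> outcome p v) * v (i, j) - of_bool ((i, j) \<in> opened p v) * box_cost I (i, j))"
  by (auto simp: payoff_def matched_value_def sum.inter_restrict finite_boxes
      simp flip: sum_subtractf intro!: sum.cong)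

lemma welfare_eq_integral_payoff: "welfare I p = (\<integral>v. payoff I p v \<partial>value_space I)"
  by (simp add: welfare_def payoff_eq_sum)

lemma borel_measurable_payoff:
  assumes "measurable_policy I p"
  shows "payoff I p \<in> borel_measurable (value_space I)"
  unfolding payoff_eq_sum
proof (intro borel_measurable_sum)
  fix b assume "b \<in> boxes I"
  then obtain i j where b: "b = (i, j)" "(i, j) \<in> boxes I" "{i, j} \<in> edges I"
    by (auto simp: boxes_def)
  have [measurable]: "Measurable.pred (value_space I) (\<lambda>v. {i, j} \<in> outcome p v)"
      "Measurable.pred (value_space I) (\<lambda>v. (i, j) \<in> opened p v)"
      "(\<lambda>v. v (i, j)) \<in> borel_measurable (value_space I)"
    using assms b measurable_component_value_space by (auto simp: measurable_policy_def)
  show "(\<lambda>v. case b of (i, j) \<Rightarrow> of_bool ({i, j} \<in> outcome p v) * v (i, j)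
      - of_bool ((i, j) \<in> opened p v) * box_cost I (i, j)) \<in> borel_measurable (value_space I)"
    unfolding b(1) prod.case by measurable
qed

lemma payoff_Open:
  assumes "b \<in> boxes I" "b \<notin> opened (k (v b)) v"
  shows "payoff I (Open b k) v = payoff I (k (v b)) v - box_cost I b"
  using assms finite_boxes by (simp add: payoff_def Int_insert_right)

lemma measurable_policy_Stop: "measurable_policy I (Stop M)"
  by (simp add: measurable_policy_def)

lemma measurable_policy_branch:
  assumes b: "b \<in> boxes I" and [measurable]: "A \<in> sets borel"
    and p: "measurable_policy I p" and q: "measurable_policy I q"
  shows "measurable_policy I (branch b A p q)"
proof -
  note [measurable] = measurable_component_value_space[OF b]
  have opened: "c \<in> opened (branch b A p q) v \<longleftrightarrow>
      c = b \<or> (if v b \<in> A then c \<in> opened p v else c \<in> opened q v)" for c v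
    by (simp add: branch_def)
  have outcome: "e \<in> outcome (branch b A p q) v \<longleftrightarrow>
      (if v b \<in> A then e \<in> outcome p v else e \<in> outcome q v)" for e v
    by (simp add: branch_def)
  show ?thesis
    unfolding measurable_policy_def opened outcome
  proof (intro conjI ballI)
    fix c assume "c \<in> boxes I"
    then have [measurable]: "Measurable.pred (value_space I) (\<lambda>v. c \<in> opened p v)"
        "Measurable.pred (value_space I) (\<lambda>v. c \<in> opened q v)"
      using p q by (auto simp: measurable_policy_def)
    show "Measurable.pred (value_space I)
        (\<lambda>v. c = b \<or> (if v b \<in> A then c \<in> opened p v else c \<in> opened q v))"
      by measurable
  next
    fix e assume "e \<in> edges I"
    then have [measurable]: "Measurable.pred (value_space I) (\<lambda>v. e \<in> outcome p v)"
        "Measurable.pred (value_space I) (\<lambda>v. e \<in> outcome q v)"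
      using p q by (auto simp: measurable_policy_def)
    show "Measurable.pred (value_space I)
        (\<lambda>v. if v b \<in> A then e \<in> outcome p v else e \<in> outcome q v)"
      by measurable
  qed
qed

end

section \<open>Finitely supported values\<close>

locale discrete_instance = valid_instance +
  fixes P :: "nat \<times> nat \<Rightarrow> real pmf"
  assumes box_dist_eq: "\<And>b. b \<in> boxes I \<Longrightarrow> box_dist I b = borel_pmf (P b)"
    and finite_support: "\<And>b. b \<in> boxes I \<Longrightarrow> finite (set_pmf (P b))"
begin

abbreviation profile_pmf :: "(nat \<times> nat \<Rightarrow> real) pmf" where
  "profile_pmf \<equiv> Pi_pmf (boxes I) undefined P"

lemma finite_set_profile_pmf: "finite (set_pmf profile_pmf)"
  using finite_boxes finite_support by (auto simp: set_Pi_pmf)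

lemma value_space_eq_distr:
  "value_space I = distr profile_pmf (PiM (boxes I) (\<lambda>_. borel)) (\<lambda>v. restrict v (boxes I))"
proof -
  have "value_space I = PiM (boxes I) (\<lambda>b. borel_pmf (P b))"
    unfolding value_space_def by (rule PiM_cong) (simp_all add: box_dist_eq)
  then show ?thesis
    using PiM_distr_pmf[OF finite_boxes, of "\<lambda>_. borel" P] by (simp add: borel_pmf_def)
qed

lemma welfare_eq_expectation:
  assumes "algorithm I p"
  shows "welfare I p = measure_pmf.expectation profile_pmf (payoff I p)"
proof -
  have measurable_payoff: "payoff I p \<in> borel_measurable (PiM (boxes I) (\<lambda>_. borel))"
    using borel_measurable_payoff assms measurable_cong_sets[OF sets_value_space refl]
    by (auto simp: algorithm_iff)
  have "welfare I p = measure_pmf.expectation profile_pmf (\<lambda>v. payoff I p (restrict v (boxes I)))"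
    unfolding welfare_eq_integral_payoff value_space_eq_distr
    by (rule integral_distr[OF _ measurable_payoff]) (simp add: space_PiM)
  also have "\<dots> = measure_pmf.expectation profile_pmf (payoff I p)"
  proof (rule integral_cong_AE)
    have "restrict v (boxes I) = v" if "v \<in> set_pmf profile_pmf" for v
      using that finite_boxes by (auto simp: set_Pi_pmf PiE_dflt_def restrict_def fun_eq_iff)
    then show "AE v in profile_pmf. payoff I p (restrict v (boxes I)) = payoff I p v"
      by (simp add: AE_measure_pmf_iff)
  qed auto
  finally show ?thesis .
qed

text \<open>
  On the finitely many value profiles of positive probability, there are only finitely many
  behaviours of a policy, hence only finitely many welfares.
\<close>

lemma finite_welfares: "finite (welfare I ` {p. algorithm I p})"
proof (rule finite_subset)
  define payoffs where "payoffs v =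
      (\<lambda>(M, B). matched_value I M v - sum (box_cost I) B) ` (Pow (edges I) \<times> Pow (boxes I))" for v
  let ?F = "PiE (set_pmf profile_pmf) payoffs"
  show "welfare I ` {p. algorithm I p} \<subseteq> measure_pmf.expectation profile_pmf ` ?F"
  proof clarify
    fix p assume p: "algorithm I p"
    have "payoff I p v \<in> payoffs v" for v
      using outcome_subset_edges[of I "{}" p v] p
      by (auto simp: payoff_def payoffs_def algorithm_iff
          intro!: image_eqI[of _ _ "(outcome p v, boxes I \<inter> opened p v)"])
    moreover have "welfare I p =
        measure_pmf.expectation profile_pmf (restrict (payoff I p) (set_pmf profile_pmf))"
      unfolding welfare_eq_expectation[OF p]
      by (rule integral_cong_AE) (auto simp: AE_measure_pmf_iff)
    ultimately show "welfare I p \<in> measure_pmf.expectation profile_pmf ` ?F"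
      by auto
  qed
  have "finite ?F"
    using finite_set_profile_pmf finite_boxes finite_edges
    by (auto simp: payoffs_def intro!: finite_PiE)
  then show "finite (measure_pmf.expectation profile_pmf ` ?F)"
    by (rule finite_imageI)
qed

lemma optimal_exists: "\<exists>opt. optimal I opt"
proof -
  let ?W = "welfare I ` {p. algorithm I p}"
  have "algorithm I (Stop {})"
    by (simp add: algorithm_iff measurable_policy_Stop del: feasible.simps)
  then have "Max ?W \<in> ?W"
    using finite_welfares by (intro Max_in) auto
  then obtain opt where "algorithm I opt" "welfare I opt = Max ?W"
    by auto
  then show ?thesis
    using finite_welfares by (auto simp: optimal_def)
qed

text \<open>Here \<open>u\<close> records the values observed so far; elsewhere it is irrelevant.\<close>

primrec policy_value :: "policy \<Rightarrow> (nat \<times> nat \<Rightarrow> real) \<Rightarrow> real" where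
  "policy_value (Stop M) u = matched_value I M u"
| "policy_value (Open b k) u =
     measure_pmf.expectation (P b) (\<lambda>x. policy_value (k x) (u(b := x))) - box_cost I b"

lemma expectation_profile_resample:
  fixes h :: "(nat \<times> nat \<Rightarrow> real) \<Rightarrow> real"
  assumes "b \<in> boxes I"
  shows "measure_pmf.expectation profile_pmf h =
    measure_pmf.expectation (P b)
      (\<lambda>x. measure_pmf.expectation profile_pmf (\<lambda>v. h (v(b := x))))"
  by (subst Pi_pmf_resample[OF finite_boxes assms], subst expectation_bind_pmf_finite)
     (simp_all add: finite_support assms finite_set_profile_pmf)

lemma expectation_payoff:
  assumes "feasible I S p"
  shows "measure_pmf.expectation profile_pmf (\<lambda>v. payoff I p (override_on v u S)) = policy_value p u"
  using assms
proof (induction p arbitrary: S u)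
  case (Stop M)
  have "payoff I (Stop M) (override_on v u S) = matched_value I M u" for v
    unfolding payoff_def matched_value_def using Stop by (auto intro!: sum.cong)
  then show ?case
    by simp
next
  case (Open b k)
  then have b: "b \<in> boxes I" "b \<notin> S" and k: "\<And>x. feasible I (insert b S) (k x)"
    by auto
  have override_upd:
    "override_on (v(b := x)) u S = override_on v (u(b := x)) (insert b S)" for v x
    using b by (auto simp: override_on_def)
  have "payoff I (Open b k) (override_on v (u(b := x)) (insert b S)) =
      payoff I (k x) (override_on v (u(b := x)) (insert b S)) - box_cost I b" for v x
    using b opened_subset[OF k] by (subst payoff_Open) auto
  then have "measure_pmf.expectation profile_pmf (\<lambda>v. payoff I (Open b k) (override_on v u S)) =
     measure_pmf.expectation (P b) (\<lambda>x. measure_pmf.expectation profile_pmf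
       (\<lambda>v. payoff I (k x) (override_on v (u(b := x)) (insert b S)) - box_cost I b))"
    by (subst expectation_profile_resample[OF b(1)]) (simp only: override_upd)
  also have "\<dots> = measure_pmf.expectation (P b)
      (\<lambda>x. policy_value (k x) (u(b := x)) - box_cost I b)"
    by (simp add: integrable_measure_pmf_finite finite_set_profile_pmf Open.IH[OF rangeI k]
        del: fun_upd_apply)
  also have "\<dots> = policy_value (Open b k) u"
    by (simp add: integrable_measure_pmf_finite finite_support b)
  finally show ?case .
qed

lemma welfare_eq_policy_value:
  assumes "algorithm I p"
  shows "welfare I p = policy_value p u"
  using expectation_payoff[of "{}" p u] assms
  by (simp add: welfare_eq_expectation algorithm_iff)

lemma policy_value_le_optimal:
  "optimal I opt \<Longrightarrow> algorithm I p \<Longrightarrow> policy_value p u \<le> welfare I opt"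
  by (metis optimal_def welfare_eq_policy_value)

lemma policy_value_branch_UNIV:
  "policy_value (branch b UNIV p q) u =
    measure_pmf.expectation (P b) (\<lambda>x. policy_value p (u(b := x))) - box_cost I b"
  by (simp add: branch_def)

lemma policy_value_branch_singleton:
  assumes "\<And>x. policy_value q (u(b := x)) = w"
  shows "policy_value (branch b {t} p q) u =
    pmf (P b) t * policy_value p (u(b := t)) + (1 - pmf (P b) t) * w - box_cost I b"
proof -
  have "(\<lambda>x. policy_value (if x \<in> {t} then p else q) (u(b := x))) =
      (\<lambda>x. if x = t then policy_value p (u(b := t)) else w)"
    using assms by auto
  then show ?thesis
    by (simp add: branch_def expectation_pmf_if_eq)
qed

definition consistent :: "(nat \<times> nat) set \<Rightarrow> (nat \<times> nat \<Rightarrow> real) \<Rightarrow> bool" where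
  "consistent S u \<longleftrightarrow> (\<forall>b\<in>S. u b \<in> set_pmf (P b))"

definition oriented_potential ::
    "(nat \<times> nat) set \<Rightarrow> ((nat \<times> nat) set \<Rightarrow> (nat \<times> nat \<Rightarrow> real) \<Rightarrow> real) \<Rightarrow> bool" where
  "oriented_potential R \<Phi> \<longleftrightarrow> (\<forall>S u. consistent S u \<longrightarrow>
     (\<forall>M. feasible I S (Stop M) \<longrightarrow> matched_value I M u \<le> \<Phi> S u) \<and>
     (\<forall>b\<in>boxes I - S. (prod.swap b \<in> R \<longrightarrow> prod.swap b \<in> S) \<longrightarrow>
        measure_pmf.expectation (P b) (\<lambda>x. \<Phi> (insert b S) (u(b := x))) - box_cost I b \<le> \<Phi> S u))"

lemma policy_value_le_potential:
  assumes \<Phi>: "oriented_potential R \<Phi>"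
    and "feasible I S p" "oriented R S p" "consistent S u"
  shows "policy_value p u \<le> \<Phi> S u"
  using assms(2-)
proof (induction p arbitrary: S u)
  case (Stop M)
  then show ?case
    using \<Phi> by (simp add: oriented_potential_def)
next
  case (Open b k)
  then have b: "b \<in> boxes I - S" "prod.swap b \<in> R \<longrightarrow> prod.swap b \<in> S"
    and k: "\<And>x. feasible I (insert b S) (k x)" "\<And>x. oriented R (insert b S) (k x)"
    by (auto simp: prod.swap_def)
  have "policy_value (k x) (u(b := x)) \<le> \<Phi> (insert b S) (u(b := x))"
    if "x \<in> set_pmf (P b)" for x
    using that Open.prems(3) by (intro Open.IH[OF rangeI k]) (auto simp: consistent_def)
  then have "measure_pmf.expectation (P b) (\<lambda>x. policy_value (k x) (u(b := x)))
      \<le> measure_pmf.expectation (P b) (\<lambda>x. \<Phi> (insert b S) (u(b := x)))"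
    using b by (intro integral_mono_AE integrable_measure_pmf_finite finite_support)
       (auto simp: AE_measure_pmf_iff)
  moreover have
    "measure_pmf.expectation (P b) (\<lambda>x. \<Phi> (insert b S) (u(b := x))) - box_cost I b \<le> \<Phi> S u"
    using \<Phi> Open.prems(3) b by (simp add: oriented_potential_def)
  ultimately show ?case
    by simp
qed

lemma welfare_le_potential:
  assumes "oriented_potential R \<Phi>" "algorithm I p" "oriented R {} p"
  shows "welfare I p \<le> \<Phi> {} u"
  using assms policy_value_le_potential[of R \<Phi> "{}" p u]
  by (simp add: welfare_eq_policy_value[of p u] algorithm_iff consistent_def)

end

section \<open>Stars\<close>

definition star :: "nat \<Rightarrow> real pmf \<Rightarrow> real \<Rightarrow> real pmf \<Rightarrow> real \<Rightarrow> pandora" where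
  "star n X c Y d = \<lparr>verts = {0..n}, edges = (\<lambda>i. {0, i}) ` {1..n},
     box_dist = (\<lambda>b. borel_pmf (if fst b = 0 then X else Y)),
     box_cost = (\<lambda>b. if fst b = 0 then c else d)\<rparr>"

lemma box_dist_star [simp]: "box_dist (star n X c Y d) b = borel_pmf (if fst b = 0 then X else Y)"
  by (simp add: star_def)

lemma box_cost_star [simp]: "box_cost (star n X c Y d) b = (if fst b = 0 then c else d)"
  by (simp add: star_def)

lemma boxes_star: "boxes (star n X c Y d) = Pair 0 ` {1..n} \<union> (\<lambda>i. (i, 0)) ` {1..n}"
  by (auto simp: boxes_def star_def doubleton_eq_iff)

lemma matching_starE:
  assumes "matching (star n X c Y d) M"
  obtains (empty) "M = {}" | (edge) i where "i \<in> {1..n}" "M = {{0, i}}"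
proof (cases "M = {}")
  case False
  then obtain e where e: "e \<in> M"
    by blast
  have M: "M \<subseteq> (\<lambda>i. {0, i}) ` {1..n}" "pairwise disjnt M"
    using assms by (auto simp: matching_def star_def)
  have "e' = e" if "e' \<in> M" for e'
  proof (rule ccontr)
    assume "e' \<noteq> e"
    then have "disjnt e' e"
      using M(2) e that by (auto simp: pairwise_def)
    moreover have "0 \<in> e" "0 \<in> e'"
      using M(1) e that by auto
    ultimately show False
      by (auto simp: disjnt_def)
  qed
  then have "M = {e}"
    using e by blast
  then show thesis
    using M(1) that(2) by auto
qed (rule that)

lemma matched_value_star_edge:
  assumes "i \<in> {1..n}"
  shows "matched_value (star n X c Y d) {{0, i}} u = u (0, i) + u (i, 0)"
proof -
  have "matched_value (star n X c Y d) {{0, i}} u = (\<Sum>b\<in>{(0, i), (i, 0)}. u b)"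
    unfolding matched_value_def using assms
    by (intro sum.mono_neutral_cong_right) (auto simp: boxes_star doubleton_eq_iff)
  then show ?thesis
    using assms by simp
qed

lemma feasible_star_edge:
  assumes "i \<in> {1..n}" "(0, i) \<in> S" "(i, 0) \<in> S"
  shows "feasible (star n X c Y d) S (Stop {{0, i}})"
  using assms by (auto simp: matching_def star_def doubleton_eq_iff)

lemma orientation_star_iff:
  assumes "orientation (star n X c Y d) R" "obeys_rule rule (star n X c Y d) R" "c \<noteq> d"
    and i: "i \<in> {1..n}"
  shows "(0, i) \<in> R \<longleftrightarrow> rule (borel_pmf X) c (borel_pmf Y) d"
    and "(i, 0) \<in> R \<longleftrightarrow> \<not> rule (borel_pmf X) c (borel_pmf Y) d"
proof -
  have box: "(0, i) \<in> boxes (star n X c Y d)"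
    using i by (simp add: boxes_star)
  show hub: "(0, i) \<in> R \<longleftrightarrow> rule (borel_pmf X) c (borel_pmf Y) d"
    using assms box by (fastforce simp: obeys_rule_def)
  show "(i, 0) \<in> R \<longleftrightarrow> \<not> rule (borel_pmf X) c (borel_pmf Y) d"
    using assms(1) box hub by (auto simp: orientation_def)
qed

locale pandora_star =
  fixes n :: nat and X :: "real pmf" and c :: real and Y :: "real pmf" and d :: real
  assumes finite_hub_support: "finite (set_pmf X)" and hub_cost_nonneg: "0 \<le> c"
    and finite_leaf_support: "finite (set_pmf Y)" and leaf_cost_nonneg: "0 \<le> d"
begin

abbreviation \<S> :: pandora where
  "\<S> \<equiv> star n X c Y d"

sublocale discrete_instance \<S> "\<lambda>b. if fst b = 0 then X else Y"
proof
  show "pandora_instance \<S>"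
    using finite_hub_support hub_cost_nonneg finite_leaf_support leaf_cost_nonneg
    by (auto simp: pandora_instance_def star_def prob_space_borel_pmf intro: integrable_borel_pmf)
qed (use finite_hub_support finite_leaf_support in simp_all)

definition inspect_leaf :: "real \<Rightarrow> policy" where
  "inspect_leaf t =
     branch (1, 0) {t} (branch (0, 1) UNIV (Stop {{0, 1}}) (Stop {})) (Stop {})"

primrec search_hub :: "real \<Rightarrow> real \<Rightarrow> nat \<Rightarrow> policy" where
  "search_hub s t 0 = Stop {}"
| "search_hub s t (Suc m) = branch (0, Suc m) {s}
     (branch (Suc m, 0) {t} (Stop {{0, Suc m}}) (Stop {})) (search_hub s t m)"

lemma algorithm_inspect_leaf:
  assumes "n \<ge> 1"
  shows "algorithm \<S> (inspect_leaf t)"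
  unfolding algorithm_iff inspect_leaf_def using assms
  by (auto intro!: feasible_branch feasible_star_edge measurable_policy_branch measurable_policy_Stop
      simp: boxes_star simp del: feasible.simps)

lemma policy_value_inspect_leaf:
  assumes "n \<ge> 1"
  shows "policy_value (inspect_leaf t) u =
    pmf Y t * (measure_pmf.expectation X (\<lambda>x. x) + t - c) - d"
proof -
  have "1 \<in> {1..n}"
    using assms by simp
  then show ?thesis
    unfolding inspect_leaf_def
    by (simp add: policy_value_branch_singleton[where w = 0] policy_value_branch_UNIV
        matched_value_star_edge[of 1, simplified] integrable_measure_pmf_finite finite_hub_support)
qed

lemma feasible_search_hub:
  assumes "m \<le> n" "S \<inter> {0..m} \<times> {0..m} = {}"
  shows "feasible \<S> S (search_hub s t m)"
  using assms
proof (induction m arbitrary: S)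
  case (Suc m)
  have "feasible \<S> (insert (0, Suc m) S) (search_hub s t m)"
    using Suc.prems by (intro Suc.IH) auto
  moreover have "(0, Suc m) \<notin> S" "(Suc m, 0) \<notin> S"
    using Suc.prems by auto
  ultimately show ?case
    using Suc.prems(1) unfolding search_hub.simps
    by (intro feasible_branch feasible_star_edge feasible_Stop_empty) (auto simp: boxes_star)
qed (simp del: feasible.simps)

lemma measurable_search_hub: "m \<le> n \<Longrightarrow> measurable_policy \<S> (search_hub s t m)"
  by (induction m)
     (auto intro!: measurable_policy_branch measurable_policy_Stop simp: boxes_star)

lemma policy_value_search_hub:
  assumes "m \<le> n" "pmf X s \<noteq> 0"
  shows "policy_value (search_hub s t m) u =
    (pmf Y t * (s + t) - d - c / pmf X s) * (1 - (1 - pmf X s) ^ m)"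
  using assms(1)
proof (induction m arbitrary: u)
  case (Suc m)
  then have "Suc m \<in> {1..n}"
    by simp
  then have "policy_value (search_hub s t (Suc m)) u =
      pmf X s * (pmf Y t * (s + t) - d) +
      (1 - pmf X s) * ((pmf Y t * (s + t) - d - c / pmf X s) * (1 - (1 - pmf X s) ^ m)) - c"
    using Suc
    by (simp add: policy_value_branch_singleton[OF Suc.IH] policy_value_branch_singleton[where w = 0]
        matched_value_star_edge)
  also have "\<dots> = (pmf Y t * (s + t) - d - c / pmf X s) * (1 - (1 - pmf X s) ^ Suc m)"
    using assms(2) by (simp add: field_simps)
  finally show ?case .
qed simp

lemma algorithm_search_hub: "algorithm \<S> (search_hub s t n)"
  by (simp add: algorithm_iff feasible_search_hub measurable_search_hub)

lemma optimal_ge_inspect_leaf: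
  assumes "optimal \<S> opt" "n \<ge> 1"
  shows "pmf Y t * (measure_pmf.expectation X (\<lambda>x. x) + t - c) - d \<le> welfare \<S> opt"
  using policy_value_le_optimal[OF assms(1) algorithm_inspect_leaf] assms(2)
  by (simp add: policy_value_inspect_leaf)

lemma optimal_ge_search_hub:
  assumes "optimal \<S> opt" "pmf X s \<noteq> 0"
  shows "(pmf Y t * (s + t) - d - c / pmf X s) * (1 - (1 - pmf X s) ^ n) \<le> welfare \<S> opt"
  using policy_value_le_optimal[OF assms(1) algorithm_search_hub, of s t] assms(2)
  by (simp add: policy_value_search_hub)

end

text \<open>
  The potential is \<open>z\<close> plus a sum over the leaves of a function \<open>f\<close> of the observed contents of the
  two boxes of the edge (\<open>None\<close> for an unopened box); \<open>z\<close> is a price that the matched edge has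
  to pay for the use of the hub.
\<close>

locale star_potential = pandora_star +
  fixes R :: "(nat \<times> nat) set" and z :: real and f :: "real option \<Rightarrow> real option \<Rightarrow> real"
  assumes z_nonneg: "0 \<le> z" and f_nonneg: "\<And>x y. 0 \<le> f x y"
    and match_le: "\<And>a b. a \<in> set_pmf X \<Longrightarrow> b \<in> set_pmf Y \<Longrightarrow> a + b \<le> z + f (Some a) (Some b)"
    and open_hub_le: "\<And>i y. i \<in> {1..n} \<Longrightarrow> ((i, 0) \<in> R \<Longrightarrow> y \<noteq> None) \<Longrightarrow>
      set_option y \<subseteq> set_pmf Y \<Longrightarrow> measure_pmf.expectation X (\<lambda>a. f (Some a) y) - c \<le> f None y"
    and open_leaf_le: "\<And>i x. i \<in> {1..n} \<Longrightarrow> ((0, i) \<in> R \<Longrightarrow> x \<noteq> None) \<Longrightarrow>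
      set_option x \<subseteq> set_pmf X \<Longrightarrow> measure_pmf.expectation Y (\<lambda>b. f x (Some b)) - d \<le> f x None"
begin

definition observed :: "(nat \<times> nat) set \<Rightarrow> (nat \<times> nat \<Rightarrow> real) \<Rightarrow> nat \<times> nat \<Rightarrow> real option" where
  "observed S u b = (if b \<in> S then Some (u b) else None)"

definition edge_potential :: "(nat \<times> nat) set \<Rightarrow> (nat \<times> nat \<Rightarrow> real) \<Rightarrow> nat \<Rightarrow> real" where
  "edge_potential S u i = f (observed S u (0, i)) (observed S u (i, 0))"

definition potential :: "(nat \<times> nat) set \<Rightarrow> (nat \<times> nat \<Rightarrow> real) \<Rightarrow> real" where
  "potential S u = z + (\<Sum>i\<in>{1..n}. edge_potential S u i)"

lemma potential_insert:
  assumes "i \<in> {1..n}" "b = (0, i) \<or> b = (i, 0)"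
  shows "potential (insert b S) (u(b := x)) =
    potential S u - edge_potential S u i + edge_potential (insert b S) (u(b := x)) i"
proof -
  have "(\<Sum>j\<in>{1..n} - {i}. edge_potential (insert b S) (u(b := x)) j) =
      (\<Sum>j\<in>{1..n} - {i}. edge_potential S u j)"
    using assms by (intro sum.cong refl) (auto simp: edge_potential_def observed_def)
  then show ?thesis
    unfolding potential_def sum.remove[OF finite_atLeastAtMost assms(1)] by simp
qed

lemma matched_value_le_potential:
  assumes "consistent S u" "feasible \<S> S (Stop M)"
  shows "matched_value \<S> M u \<le> potential S u"
proof -
  have edge_potential_nonneg: "0 \<le> edge_potential S u i" for i
    by (simp add: edge_potential_def f_nonneg)
  have "matching \<S> M"
    using assms(2) by simp
  then show ?thesis
  proof (cases rule: matching_starE)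
    case empty
    then show ?thesis
      using z_nonneg edge_potential_nonneg by (simp add: potential_def sum_nonneg)
  next
    case (edge i)
    then have opened: "(0, i) \<in> S" "(i, 0) \<in> S"
      using assms(2) by (auto simp: insert_commute)
    then have "u (0, i) \<in> set_pmf X" "u (i, 0) \<in> set_pmf Y"
      using assms(1)[unfolded consistent_def, THEN bspec] edge(1) by force+
    then have "matched_value \<S> M u \<le> z + edge_potential S u i"
      using opened edge by (simp add: matched_value_star_edge edge_potential_def observed_def match_le)
    also have "\<dots> \<le> potential S u"
      unfolding potential_def using edge edge_potential_nonneg by (simp add: member_le_sum)
    finally show ?thesis .
  qed
qed

lemma expected_edge_potential_le:
  assumes "consistent S u" "i \<in> {1..n}" "b = (0, i) \<or> b = (i, 0)" "b \<notin> S"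
    and "prod.swap b \<in> R \<longrightarrow> prod.swap b \<in> S"
  shows "measure_pmf.expectation (if fst b = 0 then X else Y)
      (\<lambda>x. edge_potential (insert b S) (u(b := x)) i) - box_cost \<S> b \<le> edge_potential S u i"
  using assms(3)
proof
  assume [simp]: "b = (0, i)"
  have "set_option (observed S u (i, 0)) \<subseteq> set_pmf Y"
    using assms(1,2) by (auto simp: observed_def consistent_def dest!: bspec[of _ _ "(i, 0)"])
  then show ?thesis
    using open_hub_le[of i "observed S u (i, 0)"] assms
    by (auto simp: edge_potential_def observed_def)
next
  assume [simp]: "b = (i, 0)"
  have "set_option (observed S u (0, i)) \<subseteq> set_pmf X"
    using assms(1,2) by (auto simp: observed_def consistent_def dest!: bspec[of _ _ "(0, i)"])
  then show ?thesis
    using open_leaf_le[of i "observed S u (0, i)"] assms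
    by (auto simp: edge_potential_def observed_def)
qed

lemma oriented_potential: "oriented_potential R potential"
  unfolding oriented_potential_def
proof (intro allI impI conjI ballI)
  fix S u b
  assume S: "consistent S u" "b \<in> boxes \<S> - S" "prod.swap b \<in> R \<longrightarrow> prod.swap b \<in> S"
  then obtain i where i: "i \<in> {1..n}" "b = (0, i) \<or> b = (i, 0)"
    by (auto simp: boxes_star)
  let ?E = "measure_pmf.expectation (if fst b = 0 then X else Y)"
  have "?E (\<lambda>x. potential (insert b S) (u(b := x))) =
      potential S u - edge_potential S u i + ?E (\<lambda>x. edge_potential (insert b S) (u(b := x)) i)"
    unfolding potential_insert[OF i]
    by (simp add: integrable_measure_pmf_finite finite_hub_support finite_leaf_support)
  then show "?E (\<lambda>x. potential (insert b S) (u(b := x))) - box_cost \<S> b \<le> potential S u"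
    using expected_edge_potential_le[OF S(1) i] S by simp
qed (rule matched_value_le_potential)

lemma welfare_le:
  assumes "algorithm \<S> p" "oriented R {} p"
  shows "welfare \<S> p \<le> z + real n * f None None"
  using welfare_le_potential[OF oriented_potential assms]
  by (simp add: potential_def edge_potential_def observed_def)

end

section \<open>Prizes and vetoes\<close>

definition prize_pmf :: "real \<Rightarrow> real pmf" where
  "prize_pmf p = two_point_pmf p (1 / p) 0"

definition veto_pmf :: "real \<Rightarrow> real pmf" where
  "veto_pmf p = two_point_pmf (1 / 2) 1 (- (1 / p))"

text \<open>
  The value \<open>2\<close> for an edge whose veto box alone is open is merely large enough: this state cannot be
  reached when the prize boxes come first.
\<close>

fun prize_first_potential :: "real \<Rightarrow> real option \<Rightarrow> real option \<Rightarrow> real" where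
  "prize_first_potential \<delta> None None = \<delta> / 2"
| "prize_first_potential \<delta> None (Some b) = 2"
| "prize_first_potential \<delta> (Some a) None = max 0 (a / 2)"
| "prize_first_potential \<delta> (Some a) (Some b) = max 0 (a + b)"

text \<open>
  With the hub priced at \<open>1\<close>, opening a veto box first is not worth its cost, so that edges with
  two closed boxes have value \<open>0\<close>.
\<close>

fun veto_first_potential :: "real \<Rightarrow> real \<Rightarrow> real option \<Rightarrow> real option \<Rightarrow> real" where
  "veto_first_potential p \<delta> None None = 0"
| "veto_first_potential p \<delta> None (Some b) = (if b = 1 then (1 + \<delta>) / 2 else 0)"
| "veto_first_potential p \<delta> (Some a) None = 1 / p"
| "veto_first_potential p \<delta> (Some a) (Some b) = max 0 (a + b - 1)"

locale prize_veto_star =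
  fixes n :: nat and p \<delta> :: real
  assumes p_bounds: "0 < p" "p \<le> 1" and \<delta>_bounds: "0 < \<delta>" "\<delta> \<le> 1"
begin

lemma set_prize_pmf_subset: "set_pmf (prize_pmf p) \<subseteq> {1 / p, 0}"
  unfolding prize_pmf_def by (rule set_two_point_pmf_subset)

lemma set_veto_pmf_subset: "set_pmf (veto_pmf p) \<subseteq> {1, - (1 / p)}"
  unfolding veto_pmf_def by (rule set_two_point_pmf_subset)

lemma expectation_prize_pmf:
  fixes f :: "real \<Rightarrow> real"
  shows "measure_pmf.expectation (prize_pmf p) f = p * f (1 / p) + (1 - p) * f 0"
  using p_bounds by (simp add: prize_pmf_def expectation_two_point_pmf)

lemma expectation_veto_pmf:
  fixes f :: "real \<Rightarrow> real"
  shows "measure_pmf.expectation (veto_pmf p) f = (f 1 + f (- (1 / p))) / 2"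
  by (simp add: veto_pmf_def expectation_two_point_pmf)

lemma pmf_prize_pmf: "pmf (prize_pmf p) (1 / p) = p"
  using p_bounds by (simp add: prize_pmf_def pmf_two_point_pmf_left)

lemma pmf_veto_pmf: "pmf (veto_pmf p) 1 = 1 / 2"
proof -
  have "1 / p > 0"
    using p_bounds by simp
  then have "1 \<noteq> - (1 / p)"
    by linarith
  then show ?thesis
    by (simp add: veto_pmf_def pmf_two_point_pmf_left)
qed

sublocale pandora_star n "prize_pmf p" "(1 - \<delta>) / 2" "veto_pmf p" "1 / 2"
  using \<delta>_bounds by unfold_locales
    (auto intro: finite_subset[OF set_prize_pmf_subset] finite_subset[OF set_veto_pmf_subset])

lemma star_potential_prize_first:
  assumes R: "\<And>i. i \<in> {1..n} \<Longrightarrow> (0, i) \<in> R"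
  shows "star_potential n (prize_pmf p) ((1 - \<delta>) / 2) (veto_pmf p) (1 / 2) R 0
    (prize_first_potential \<delta>)"
proof
  show "0 \<le> prize_first_potential \<delta> x y" for x y
    using \<delta>_bounds by (cases x; cases y) auto
next
  fix y assume "set_option y \<subseteq> set_pmf (veto_pmf p)"
  then have "y \<in> {None, Some 1, Some (- (1 / p))}"
    using set_veto_pmf_subset by (cases y) auto
  then show "measure_pmf.expectation (prize_pmf p) (\<lambda>a. prize_first_potential \<delta> (Some a) y)
      - (1 - \<delta>) / 2 \<le> prize_first_potential \<delta> None y"
    using p_bounds \<delta>_bounds by (auto simp: expectation_prize_pmf field_simps max_def)
next
  fix i x assume "i \<in> {1..n}" "(0, i) \<in> R \<Longrightarrow> x \<noteq> None" "set_option x \<subseteq> set_pmf (prize_pmf p)"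
  then have "x \<in> {Some 0, Some (1 / p)}"
    using R set_prize_pmf_subset by (cases x) auto
  then show "measure_pmf.expectation (veto_pmf p) (\<lambda>b. prize_first_potential \<delta> x (Some b))
      - 1 / 2 \<le> prize_first_potential \<delta> x None"
    using p_bounds by (auto simp: expectation_veto_pmf field_simps max_def)
qed simp_all

lemma star_potential_veto_first:
  assumes R: "\<And>i. i \<in> {1..n} \<Longrightarrow> (i, 0) \<in> R"
  shows "star_potential n (prize_pmf p) ((1 - \<delta>) / 2) (veto_pmf p) (1 / 2) R 1
    (veto_first_potential p \<delta>)"
proof
  show "0 \<le> veto_first_potential p \<delta> x y" for x y
    using p_bounds \<delta>_bounds by (cases x; cases y) auto
next
  fix i y assume "i \<in> {1..n}" "(i, 0) \<in> R \<Longrightarrow> y \<noteq> None" "set_option y \<subseteq> set_pmf (veto_pmf p)"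
  then have "y \<in> {Some 1, Some (- (1 / p))}"
    using R set_veto_pmf_subset by (cases y) auto
  then show "measure_pmf.expectation (prize_pmf p) (\<lambda>a. veto_first_potential p \<delta> (Some a) y)
      - (1 - \<delta>) / 2 \<le> veto_first_potential p \<delta> None y"
    using p_bounds \<delta>_bounds by (auto simp: expectation_prize_pmf field_simps max_def)
next
  fix x assume "set_option x \<subseteq> set_pmf (prize_pmf p)"
  then have "x \<in> {None, Some 0, Some (1 / p)}"
    using set_prize_pmf_subset by (cases x) auto
  then show "measure_pmf.expectation (veto_pmf p) (\<lambda>b. veto_first_potential p \<delta> x (Some b))
      - 1 / 2 \<le> veto_first_potential p \<delta> x None"
    using p_bounds \<delta>_bounds by (auto simp: expectation_veto_pmf field_simps max_def)
qed simp_all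

lemma prize_first_welfare_le:
  assumes "algorithm \<S> q" "oriented R {} q" "\<And>i. i \<in> {1..n} \<Longrightarrow> (0, i) \<in> R"
  shows "welfare \<S> q \<le> real n * \<delta> / 2"
  using star_potential.welfare_le[OF star_potential_prize_first] assms by fastforce

lemma veto_first_welfare_le:
  assumes "algorithm \<S> q" "oriented R {} q" "\<And>i. i \<in> {1..n} \<Longrightarrow> (i, 0) \<in> R"
  shows "welfare \<S> q \<le> 1"
  using star_potential.welfare_le[OF star_potential_veto_first] assms by fastforce

lemma optimal_ge_veto_first:
  assumes "optimal \<S> opt" "n \<ge> 1"
  shows "(1 + \<delta>) / 4 \<le> welfare \<S> opt"
  using optimal_ge_inspect_leaf[OF assms, of 1] p_bounds
  by (simp add: pmf_veto_pmf expectation_prize_pmf field_simps)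

lemma optimal_ge_prize_search:
  assumes "optimal \<S> opt"
  shows "\<delta> / (2 * p) * (1 - (1 - p) ^ n) \<le> welfare \<S> opt"
proof -
  have "1 / 2 * (1 / p + 1) - 1 / 2 - (1 - \<delta>) / 2 / p = \<delta> / (2 * p)"
    using p_bounds by (simp add: field_simps)
  then show ?thesis
    using optimal_ge_search_hub[OF assms, of "1 / p" 1] p_bounds
    by (simp only: pmf_veto_pmf pmf_prize_pmf)
qed

lemma prize_first_welfare_less:
  assumes "algorithm \<S> q" "oriented R {} q" "\<And>i. i \<in> {1..n} \<Longrightarrow> (0, i) \<in> R"
    and "optimal \<S> opt" "n = 1" "2 * \<delta> \<le> \<alpha>"
  shows "welfare \<S> q < \<alpha> * welfare \<S> opt"
proof -
  have "welfare \<S> q \<le> \<delta> / 2"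
    using prize_first_welfare_le[OF assms(1-3)] \<open>n = 1\<close> by simp
  also have "\<dots> < 2 * \<delta> * ((1 + \<delta>) / 4)"
    using \<delta>_bounds by simp
  also have "\<dots> \<le> \<alpha> * welfare \<S> opt"
    using optimal_ge_veto_first[OF assms(4)] assms(5,6) \<delta>_bounds by (intro mult_mono) auto
  finally show ?thesis .
qed

lemma veto_first_welfare_less:
  assumes "algorithm \<S> q" "oriented R {} q" "\<And>i. i \<in> {1..n} \<Longrightarrow> (i, 0) \<in> R"
    and "optimal \<S> opt" "(1 - p) ^ n < 1 / 2" "4 * p \<le> \<alpha> * \<delta>"
  shows "welfare \<S> q < \<alpha> * welfare \<S> opt"
proof -
  have "\<alpha> * \<delta> > 0"
    using assms(6) p_bounds by linarith
  then have "\<alpha> > 0"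
    using \<delta>_bounds by (simp add: zero_less_mult_iff)
  have "welfare \<S> q \<le> 1"
    using veto_first_welfare_le[OF assms(1-3)] .
  also have "\<dots> \<le> \<alpha> * (\<delta> / (2 * p) * (1 / 2))"
    using assms(6) p_bounds by (simp add: field_simps)
  also have "\<dots> < \<alpha> * (\<delta> / (2 * p) * (1 - (1 - p) ^ n))"
    using assms(5) p_bounds \<delta>_bounds \<open>\<alpha> > 0\<close> by (intro mult_strict_left_mono) auto
  also have "\<dots> \<le> \<alpha> * welfare \<S> opt"
    using optimal_ge_prize_search[OF assms(4)] \<open>\<alpha> > 0\<close> by (intro mult_left_mono) auto
  finally show ?thesis .
qed

end

lemma edge_rule_welfare_less:
  fixes rule :: edge_rule and \<alpha> :: real
  assumes "\<alpha> > 0"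
  obtains I opt where "pandora_instance I" "optimal I opt"
    "\<And>R q. orientation I R \<Longrightarrow> obeys_rule rule I R \<Longrightarrow> algorithm I q \<Longrightarrow> oriented R {} q \<Longrightarrow>
      welfare I q < \<alpha> * welfare I opt"
proof -
  define \<delta> p where "\<delta> = min 1 (\<alpha> / 4)" and "p = \<delta>\<^sup>2"
  have \<delta>_bounds: "0 < \<delta>" "\<delta> \<le> 1" and p_bounds: "0 < p" "p \<le> 1"
    and ratios: "2 * \<delta> \<le> \<alpha>" "4 * p \<le> \<alpha> * \<delta>"
    using assms by (auto simp: \<delta>_def p_def power2_eq_square mult_le_one)
  obtain N where N: "(1 - p) ^ N < 1 / 2"
    using real_arch_pow_inv[of "1 / 2" "1 - p"] p_bounds by auto
  define prize_first where
    "prize_first \<longleftrightarrow> rule (borel_pmf (prize_pmf p)) ((1 - \<delta>) / 2) (borel_pmf (veto_pmf p)) (1 / 2)"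
  define n where "n = (if prize_first then 1 else N)"
  interpret prize_veto_star n p \<delta>
    using p_bounds \<delta>_bounds by unfold_locales
  obtain opt where opt: "optimal \<S> opt"
    using optimal_exists by blast
  have "welfare \<S> q < \<alpha> * welfare \<S> opt"
    if R: "orientation \<S> R" "obeys_rule rule \<S> R" and q: "algorithm \<S> q" "oriented R {} q" for R q
  proof (cases prize_first)
    case True
    then have "(0, i) \<in> R" if "i \<in> {1..n}" for i
      using orientation_star_iff(1)[OF R _ that] \<delta>_bounds by (simp add: prize_first_def)
    then show ?thesis
      using True ratios by (intro prize_first_welfare_less[OF q _ opt]) (auto simp: n_def)
  next
    case False
    then have "(i, 0) \<in> R" if "i \<in> {1..n}" for i
      using orientation_star_iff(2)[OF R _ that] \<delta>_bounds by (simp add: prize_first_def)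
    then show ?thesis
      using False N ratios by (intro veto_first_welfare_less[OF q _ opt]) (auto simp: n_def)
  qed
  then show thesis
    using that pandora_instance opt by blast
qed

theorem theorem3:
  fixes alg :: "pandora \<Rightarrow> policy" and \<alpha> :: real
  assumes "edge_based_fixed_orientation alg" and "\<alpha> > 0"
  shows "\<exists>I opt. pandora_instance I \<and> optimal I opt \<and> welfare I (alg I) < \<alpha> * welfare I opt"
proof -
  obtain rule where rule: "\<And>I. pandora_instance I \<Longrightarrow> algorithm I (alg I) \<and>
      (\<exists>R. orientation I R \<and> obeys_rule rule I R \<and> oriented R {} (alg I))"
    using assms(1) by (auto simp: edge_based_fixed_orientation_def)
  obtain I opt where I: "pandora_instance I" "optimal I opt"
    and less: "\<And>R q. orientation I R \<Longrightarrow> obeys_rule rule I R \<Longrightarrow> algorithm I q \<Longrightarrow> oriented R {} q \<Longrightarrow>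
      welfare I q < \<alpha> * welfare I opt"
    using edge_rule_welfare_less[OF assms(2), of rule] by blast
  have "welfare I (alg I) < \<alpha> * welfare I opt"
    using rule[OF I(1)] less by blast
  then show ?thesis
    using I by blast
qed

end
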